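(* There is an algorithm that, given a partial oracle $O_P$ for a partial order $P$ on an $n$-element set $X$ such that $P$ contains an (unknown) maximum chain of length $n-k$, computes, using $O(n \log n)$ partial oracle queries and $O(n \log n)$ time, a chain of $P$ of length $n - 2k$.
   Context: A partial oracle $O_P$ answers, for any ordered pair $(x_i,x_j)$ of distinct elements, whether $x_i \prec_P x_j$. A chain in $P$ is a set of pairwise comparable elements; its length is its cardinality; a maximum chain is one of maximal length. *)

theory Defs
  imports Complex_Main "HOL-Library.Landau_Symbols"
begin

text \<open>
  A partial order is given by its reflexive relation, as in \<^const>\<open>partial_order_on\<close>;
  \<open>prec\<close> is its strict part.  For a partial order on \<open>X\<close> the members of \<^const>\<open>Chains\<close>
  are exactly the pairwise comparable subsets of \<open>X\<close>.
\<close>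

definition prec :: "'a rel \<Rightarrow> 'a \<Rightarrow> 'a \<Rightarrow> bool" where
  "prec P x y \<longleftrightarrow> (x, y) \<in> P \<and> x \<noteq> y"

definition maximum_chain :: "'a rel \<Rightarrow> 'a set \<Rightarrow> bool" where
  "maximum_chain P C \<longleftrightarrow> C \<in> Chains P \<and> (\<forall>D \<in> Chains P. card D \<le> card C)"

text \<open>
  The ground set is enumerated by a list \<open>xs\<close>, and algorithms refer to its elements by their
  positions in \<open>xs\<close>.  Nothing is assumed about the answers to queries that are not
  pairs of positions of two distinct elements.
\<close>

definition partial_oracle :: "'a list \<Rightarrow> 'a rel \<Rightarrow> (nat \<Rightarrow> nat \<Rightarrow> bool) \<Rightarrow> bool" where
  "partial_oracle xs P orc \<longleftrightarrow>
     (\<forall>i < length xs. \<forall>j < length xs. i \<noteq> j \<longrightarrow> orc i j = prec P (xs ! i) (xs ! j))"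

text \<open>
  Algorithms are structured programs for a word RAM with an oracle.  A program uses finitely
  many registers and finitely many randomly accessible arrays, all holding natural numbers.
  Truth values are numbers, with \<open>0\<close> for false and \<open>1\<close> for true.
\<close>

record state =
  regs :: "string \<Rightarrow> nat"
  arrs :: "string \<Rightarrow> nat \<Rightarrow> nat"

datatype exp =
    Num nat
  | Reg string
  | Arr string exp
  | Plus exp exp
  | Minus exp exp
  | Less exp exp

datatype com =
    Skip
  | Assign string exp
  | Store string exp exp
  | Query string exp exp
  | Seq com com
  | Cond exp com com
  | While exp com

text \<open>\<^const>\<open>Minus\<close> is truncated subtraction.\<close>

fun val :: "exp \<Rightarrow> state \<Rightarrow> nat" where
  "val (Num m) s = m"
| "val (Reg x) s = regs s x"
| "val (Arr a e) s = arrs s a (val e s)"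
| "val (Plus e f) s = val e s + val f s"
| "val (Minus e f) s = val e s - val f s"
| "val (Less e f) s = (if val e s < val f s then 1 else 0)"

text \<open>
  The time to evaluate an expression is its number of nodes: every constant, register access,
  array access and arithmetic operation takes one unit.
\<close>

fun cost :: "exp \<Rightarrow> nat" where
  "cost (Num m) = 1"
| "cost (Reg x) = 1"
| "cost (Arr a e) = 1 + cost e"
| "cost (Plus e f) = 1 + cost e + cost f"
| "cost (Minus e f) = 1 + cost e + cost f"
| "cost (Less e f) = 1 + cost e + cost f"

text \<open>
  Unit cost is only realistic for numbers that fit into a machine word.  \<open>fits W e s\<close> says
  that no number exceeding \<open>W\<close> occurs in the evaluation of \<open>e\<close>.
\<close>

fun fits :: "nat \<Rightarrow> exp \<Rightarrow> state \<Rightarrow> bool" where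
  "fits W (Num m) s \<longleftrightarrow> val (Num m) s \<le> W"
| "fits W (Reg x) s \<longleftrightarrow> val (Reg x) s \<le> W"
| "fits W (Arr a e) s \<longleftrightarrow> fits W e s \<and> val (Arr a e) s \<le> W"
| "fits W (Plus e f) s \<longleftrightarrow> fits W e s \<and> fits W f s \<and> val (Plus e f) s \<le> W"
| "fits W (Minus e f) s \<longleftrightarrow> fits W e s \<and> fits W f s \<and> val (Minus e f) s \<le> W"
| "fits W (Less e f) s \<longleftrightarrow> fits W e s \<and> fits W f s \<and> val (Less e f) s \<le> W"

abbreviation set_reg :: "string \<Rightarrow> nat \<Rightarrow> state \<Rightarrow> state" where
  "set_reg x v s \<equiv> s\<lparr>regs := (regs s)(x := v)\<rparr>"

abbreviation set_arr :: "string \<Rightarrow> nat \<Rightarrow> nat \<Rightarrow> state \<Rightarrow> state" where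
  "set_arr a i v s \<equiv> s\<lparr>arrs := (arrs s)(a := (arrs s a)(i := v))\<rparr>"

text \<open>
  \<open>exec W orc c s t q s'\<close>: started in state \<open>s\<close>, program \<open>c\<close> terminates in state \<open>s'\<close> after
  \<open>t\<close> units of time and \<open>q\<close> oracle queries, all numbers being at most \<open>W\<close>.  A program that
  leaves the word range has no terminating execution.
\<close>

inductive exec ::
  "nat \<Rightarrow> (nat \<Rightarrow> nat \<Rightarrow> bool) \<Rightarrow> com \<Rightarrow> state \<Rightarrow> nat \<Rightarrow> nat \<Rightarrow> state \<Rightarrow> bool"
  for W :: nat and orc :: "nat \<Rightarrow> nat \<Rightarrow> bool"
where
  Skip: "exec W orc Skip s 1 0 s"
| Assign: "fits W e s \<Longrightarrow>
    exec W orc (Assign x e) s (1 + cost e) 0 (set_reg x (val e s) s)"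
| Store: "fits W e s \<Longrightarrow> fits W f s \<Longrightarrow>
    exec W orc (Store a e f) s (1 + cost e + cost f) 0 (set_arr a (val e s) (val f s) s)"
| Query: "fits W e s \<Longrightarrow> fits W f s \<Longrightarrow>
    exec W orc (Query x e f) s (1 + cost e + cost f) 1
      (set_reg x (if orc (val e s) (val f s) then 1 else 0) s)"
| Seq: "exec W orc c s t q s' \<Longrightarrow> exec W orc d s' t' q' s'' \<Longrightarrow>
    exec W orc (Seq c d) s (t + t') (q + q') s''"
| CondTrue: "fits W e s \<Longrightarrow> val e s \<noteq> 0 \<Longrightarrow> exec W orc c s t q s' \<Longrightarrow>
    exec W orc (Cond e c d) s (1 + cost e + t) q s'"
| CondFalse: "fits W e s \<Longrightarrow> val e s = 0 \<Longrightarrow> exec W orc d s t q s' \<Longrightarrow>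
    exec W orc (Cond e c d) s (1 + cost e + t) q s'"
| WhileFalse: "fits W e s \<Longrightarrow> val e s = 0 \<Longrightarrow>
    exec W orc (While e c) s (1 + cost e) 0 s"
| WhileTrue: "fits W e s \<Longrightarrow> val e s \<noteq> 0 \<Longrightarrow> exec W orc c s t q s' \<Longrightarrow>
    exec W orc (While e c) s' t' q' s'' \<Longrightarrow>
    exec W orc (While e c) s (1 + cost e + t + t') (q + q') s''"

inductive_cases exec_SkipE: "exec W orc Skip s t q s'"
inductive_cases exec_AssignE: "exec W orc (Assign x e) s t q s'"
inductive_cases exec_StoreE: "exec W orc (Store a e f) s t q s'"
inductive_cases exec_QueryE: "exec W orc (Query x e f) s t q s'"
inductive_cases exec_SeqE: "exec W orc (Seq c d) s t q s'"
inductive_cases exec_CondE: "exec W orc (Cond e c d) s t q s'"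
inductive_cases exec_WhileE: "exec W orc (While e c) s t q s'"

text \<open>Executions are unique, so it suffices to assert that one with the desired properties exists.\<close>

lemma exec_deterministic:
  assumes "exec W orc c s t q s'" and "exec W orc c s t2 q2 s2"
  shows "t2 = t \<and> q2 = q \<and> s2 = s'"
  using assms
proof (induction arbitrary: t2 q2 s2 rule: exec.induct)
  case (Skip s)
  then show ?case by (elim exec_SkipE) simp
next
  case (Assign e s x)
  from Assign.prems show ?case by (elim exec_AssignE) simp
next
  case (Store e s f a)
  from Store.prems show ?case by (elim exec_StoreE) simp
next
  case (Query e s f x)
  from Query.prems show ?case by (elim exec_QueryE) simp
next
  case (Seq c s t q s' d t' q' s'')
  from Seq.prems obtain u r v u' r' where
    "exec W orc c s u r v" "exec W orc d v u' r' s2" "t2 = u + u'" "q2 = r + r'"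
    by (rule exec_SeqE)
  moreover from this(1) have "u = t \<and> r = q \<and> v = s'" by (rule Seq.IH(1))
  ultimately show ?case using Seq.IH(2)[of u' r' s2] by simp
next
  case (CondTrue e s c t q s' d)
  from CondTrue.prems CondTrue.hyps(2) obtain u where
    u: "t2 = 1 + cost e + u" "exec W orc c s u q2 s2"
    by (cases rule: exec_CondE) auto
  from CondTrue.IH[OF u(2)] u(1) show ?case by simp
next
  case (CondFalse e s d t q s' c)
  from CondFalse.prems CondFalse.hyps(2) obtain u where
    u: "t2 = 1 + cost e + u" "exec W orc d s u q2 s2"
    by (cases rule: exec_CondE) auto
  from CondFalse.IH[OF u(2)] u(1) show ?case by simp
next
  case (WhileFalse e s c)
  from WhileFalse.prems WhileFalse.hyps(2) show ?case
    by (cases rule: exec_WhileE) auto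
next
  case (WhileTrue e s c t q s' t' q' s'')
  from WhileTrue.prems WhileTrue.hyps(2) obtain u r v u' r' where
    "exec W orc c s u r v" "exec W orc (While e c) v u' r' s2"
    "t2 = 1 + cost e + u + u'" "q2 = r + r'"
    by (cases rule: exec_WhileE) auto
  moreover from this(1) have "u = t \<and> r = q \<and> v = s'" by (rule WhileTrue.IH(1))
  ultimately show ?case using WhileTrue.IH(2)[of u' r' s2] by simp
qed

text \<open>The input is a register assignment; all other memory is initially zero.\<close>

definition input_state :: "(string \<Rightarrow> nat) \<Rightarrow> state" where
  "input_state inp = \<lparr>regs = inp, arrs = (\<lambda>_ _. 0)\<rparr>"

definition output_list :: "state \<Rightarrow> nat list" where
  "output_list s = map (arrs s ''out'') [0..<regs s ''len'']"

text \<open>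
  Numbers are bounded by \<open>(n + 2) ^ d\<close>, that is, words have \<open>d * log 2 (n + 2)\<close> bits.
\<close>

definition computes_within ::
  "com \<Rightarrow> nat \<Rightarrow> nat \<Rightarrow> (nat \<Rightarrow> nat \<Rightarrow> bool) \<Rightarrow> (string \<Rightarrow> nat) \<Rightarrow> real \<Rightarrow> real \<Rightarrow> nat list \<Rightarrow> bool"
where
  "computes_within alg d n orc inp T Q out \<longleftrightarrow>
     (\<exists>t q s. exec ((n + 2) ^ d) orc alg (input_state inp) t q s \<and>
        real t \<le> T \<and> real q \<le> Q \<and> output_list s = out)"

text \<open>The positions in \<open>out\<close> list, without repetition, the elements of a chain.\<close>

definition lists_chain :: "'a list \<Rightarrow> 'a rel \<Rightarrow> nat list \<Rightarrow> bool" where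
  "lists_chain xs P out \<longleftrightarrow>
     distinct out \<and> set out \<subseteq> {..<length xs} \<and> (!) xs ` set out \<in> Chains P"

end

theory Submission
  imports Defs "HOL-Library.Multiset" "HOL-Library.Log_Nat"
begin

text \<open>
  Run bottom-up merge sort, but whenever the heads of the two runs being merged are incomparable,
  discard both.  The discarded pairs are disjoint, and each contains an element outside a fixed
  chain of length \<open>n - k\<close>; so at most \<open>k\<close> pairs are discarded, and what remains is a sorted chain
  of length at least \<open>n - 2k\<close>.  Equivalently, the number of surviving elements of that chain
  minus the number of other survivors never drops below its initial value \<open>(n - k) - k\<close>.
  A prefix of the result has length exactly \<open>n - 2k\<close>.
\<close>

subsection \<open>Weakest preconditions with time\<close>

text \<open>Incomparability is in general not transitive, so a merge cannot treat incomparable heads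
  as a tie; dropping both is safe because removing elements leaves either run sorted. The obstacle
  is that runs then shrink irregularly and may become empty. Run boundaries can therefore not be
  computed from indices as in a usual bottom-up sort: the lengths are stored, and empty runs are
  kept, so that the number of rounds depends on \<open>n\<close> alone and not on the oracle.
  Working bottom-up suits a language with loops but without procedure calls. The signed count
  replaces a record of the discarded pairs because it is additive over concatenation: one inequality
  about merging two runs gives an invariant of the whole sort. Neither \<open>k\<close> nor the
  chain enters the sorting program.\<close>

lemma exec_queries_le_time: "exec W orc c s t q s' \<Longrightarrow> q \<le> t"
  by (induction rule: exec.induct) auto

text \<open>Queries do not appear in the postcondition: each of them takes time, so a time bound is
  a query bound as well. Existence of an execution includes termination and staying in the word
  range.\<close>

definition wp ::
  "nat \<Rightarrow> (nat \<Rightarrow> nat \<Rightarrow> bool) \<Rightarrow> com \<Rightarrow> state \<Rightarrow> (state \<Rightarrow> nat \<Rightarrow> bool) \<Rightarrow> bool" where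
  "wp W orc c s R \<longleftrightarrow> (\<exists>t q s'. exec W orc c s t q s' \<and> R s' t)"

lemma wp_mono: "wp W orc c s R \<Longrightarrow> (\<And>s' t. R s' t \<Longrightarrow> R' s' t) \<Longrightarrow> wp W orc c s R'"
  unfolding wp_def by blast

lemma wp_Assign: "wp W orc (Assign x e) s R \<longleftrightarrow>
    fits W e s \<and> R (set_reg x (val e s) s) (1 + cost e)"
  unfolding wp_def by (auto intro: exec.Assign[simplified] elim!: exec_AssignE)

lemma wp_Store: "wp W orc (Store a e f) s R \<longleftrightarrow>
    fits W e s \<and> fits W f s \<and> R (set_arr a (val e s) (val f s) s) (1 + cost e + cost f)"
  unfolding wp_def by (auto intro: exec.Store[simplified] elim!: exec_StoreE)

lemma wp_Query: "wp W orc (Query x e f) s R \<longleftrightarrow>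
    fits W e s \<and> fits W f s \<and>
    R (set_reg x (if orc (val e s) (val f s) then 1 else 0) s) (1 + cost e + cost f)"
  unfolding wp_def
  by (rule iffI, (elim exE conjE, erule exec_QueryE, simp),
      intro exI conjI, rule exec.Query, auto)

lemma wp_Seq: "wp W orc (Seq c d) s R \<longleftrightarrow>
    wp W orc c s (\<lambda>s' t. wp W orc d s' (\<lambda>s'' t'. R s'' (t + t')))"
  unfolding wp_def by (blast intro: exec.Seq elim: exec_SeqE)

lemma wp_Cond: "wp W orc (Cond e c d) s R \<longleftrightarrow>
    fits W e s \<and> wp W orc (if val e s \<noteq> 0 then c else d) s (\<lambda>s' t. R s' (1 + cost e + t))"
  unfolding wp_def
  by (auto elim!: exec_CondE) (blast intro: exec.CondTrue[simplified] exec.CondFalse[simplified])+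

lemmas wp_simps = wp_Assign wp_Store wp_Query wp_Seq wp_Cond

section \<open>Frame conditions and a rule for loops\<close>

fun written_regs :: "com \<Rightarrow> string set" where
  "written_regs Skip = {}"
| "written_regs (Assign x e) = {x}"
| "written_regs (Store a e f) = {}"
| "written_regs (Query x e f) = {x}"
| "written_regs (Seq c d) = written_regs c \<union> written_regs d"
| "written_regs (Cond e c d) = written_regs c \<union> written_regs d"
| "written_regs (While e c) = written_regs c"

fun written_arrs :: "com \<Rightarrow> string set" where
  "written_arrs Skip = {}"
| "written_arrs (Assign x e) = {}"
| "written_arrs (Store a e f) = {a}"
| "written_arrs (Query x e f) = {}"
| "written_arrs (Seq c d) = written_arrs c \<union> written_arrs d"
| "written_arrs (Cond e c d) = written_arrs c \<union> written_arrs d"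
| "written_arrs (While e c) = written_arrs c"

definition unchanged :: "com \<Rightarrow> state \<Rightarrow> state \<Rightarrow> bool" where
  "unchanged c s s' \<longleftrightarrow> (\<forall>x. x \<notin> written_regs c \<longrightarrow> regs s' x = regs s x) \<and>
     (\<forall>a. a \<notin> written_arrs c \<longrightarrow> arrs s' a = arrs s a)"

lemma exec_unchanged: "exec W orc c s t q s' \<Longrightarrow> unchanged c s s'"
  by (induction rule: exec.induct) (auto simp: unchanged_def)

lemma wp_unchanged:
  assumes "wp W orc c s R" and "\<And>s' t. unchanged c s s' \<Longrightarrow> R s' t \<Longrightarrow> R' s' t"
  shows "wp W orc c s R'"
  using assms exec_unchanged unfolding wp_def by blast

text \<open>\<open>\<Phi>\<close> is a prepaid time budget: its drop must cover an iteration
  together with its guard. As guards cost something, this also proves termination. The failing last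
  guard accounts for the extra \<open>1 + cost e\<close>. The relation
  \<open>unchanged c s0 s\<close> comes for free, so an invariant only has to describe what the body
  writes.\<close>

lemma wp_While:
  fixes \<Phi> :: "state \<Rightarrow> nat"
  assumes I: "I s0"
    and fits: "\<And>s. unchanged c s0 s \<Longrightarrow> I s \<Longrightarrow> fits W e s"
    and body: "\<And>s. unchanged c s0 s \<Longrightarrow> I s \<Longrightarrow> val e s \<noteq> 0 \<Longrightarrow>
      wp W orc c s (\<lambda>s' t. I s' \<and> \<Phi> s' + t + 1 + cost e \<le> \<Phi> s)"
    and final: "\<And>s t. unchanged c s0 s \<Longrightarrow> I s \<Longrightarrow> val e s = 0 \<Longrightarrow>
      t + \<Phi> s \<le> \<Phi> s0 + 1 + cost e \<Longrightarrow> R s t"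
  shows "wp W orc (While e c) s0 R"
proof -
  have "\<exists>t q s'. exec W orc (While e c) s t q s' \<and> I s' \<and> val e s' = 0 \<and>
      t + \<Phi> s' \<le> \<Phi> s + 1 + cost e"
    if "I s" "unchanged c s0 s" for s
    using that
  proof (induction "\<Phi> s" arbitrary: s rule: less_induct)
    case less
    show ?case
    proof (cases "val e s = 0")
      case True
      then show ?thesis
        using exec.WhileFalse[OF fits True] less.prems by (metis add.assoc add.commute order_refl)
    next
      case False
      then obtain t q s' where 1: "exec W orc c s t q s'" "I s'" "\<Phi> s' + t + 1 + cost e \<le> \<Phi> s"
        using body less.prems unfolding wp_def by blast
      then have "unchanged c s0 s'"
        using exec_unchanged[OF 1(1)] less.prems(2) by (simp add: unchanged_def)
      then obtain t' q' s'' where 2: "exec W orc (While e c) s' t' q' s''" "I s''"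
        "val e s'' = 0" "t' + \<Phi> s'' \<le> \<Phi> s' + 1 + cost e"
        using less.hyps[of s'] 1 by auto
      have "1 + cost e + t + t' + \<Phi> s'' \<le> \<Phi> s + 1 + cost e"
        using 1 2 by linarith
      then show ?thesis
        using exec.WhileTrue[OF fits False 1(1) 2(1)] less.prems 2 by blast
    qed
  qed
  from this[OF I] obtain t q s' where *: "exec W orc (While e c) s0 t q s'" "I s'"
    "val e s' = 0" "t + \<Phi> s' \<le> \<Phi> s0 + 1 + cost e"
    by (auto simp: unchanged_def)
  moreover have "unchanged c s0 s'"
    using exec_unchanged[OF *(1)] by (simp add: unchanged_def)
  ultimately show ?thesis
    using final unfolding wp_def by blast
qed

subsection \<open>Merging with cancellation\<close>

fun merge_cancel :: "('a \<Rightarrow> 'a \<Rightarrow> bool) \<Rightarrow> 'a list \<Rightarrow> 'a list \<Rightarrow> 'a list" where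
  "merge_cancel lt [] ys = ys"
| "merge_cancel lt (x # xs) [] = x # xs"
| "merge_cancel lt (x # xs) (y # ys) =
    (if lt x y then x # merge_cancel lt xs (y # ys)
     else if lt y x then y # merge_cancel lt (x # xs) ys
     else merge_cancel lt xs ys)"

lemma merge_cancel_Nil2 [simp]: "merge_cancel lt xs [] = xs"
  by (cases xs) auto

fun merge_pairs :: "('a \<Rightarrow> 'a \<Rightarrow> bool) \<Rightarrow> 'a list list \<Rightarrow> 'a list list" where
  "merge_pairs lt [] = []"
| "merge_pairs lt [xs] = [xs]"
| "merge_pairs lt (xs # ys # zss) = merge_cancel lt xs ys # merge_pairs lt zss"

lemma length_merge_cancel: "length (merge_cancel lt xs ys) \<le> length xs + length ys"
  by (induction lt xs ys rule: merge_cancel.induct) auto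

text \<open>Cancellation shortens runs but never removes one from the list, so their number halves
  whatever \<open>lt\<close> answers. This makes the number of rounds logarithmic.\<close>

lemma length_merge_pairs: "length (merge_pairs lt xss) = (length xss + 1) div 2"
  by (induction lt xss rule: merge_pairs.induct) auto

text \<open>Multisets are used because the version of this inclusion for a whole round yields
  distinctness, membership and the length bound at once.\<close>

lemma mset_merge_cancel: "mset (merge_cancel lt xs ys) \<subseteq># mset xs + mset ys"
proof (induction lt xs ys rule: merge_cancel.induct)
  case (3 lt x xs y ys)
  consider "lt x y" | "\<not> lt x y" "lt y x" | "\<not> lt x y" "\<not> lt y x" by blast
  then show ?case
  proof cases
    case 1
    then show ?thesis using "3.IH"(1) by simp
  next
    case 2
    then show ?thesis using "3.IH"(2) by simp
  next
    case 3
    have "mset xs + mset ys \<subseteq># mset (x # xs) + mset (y # ys)"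
      by (simp add: subset_mset.add_increasing)
    with 3 "3.IH"(3) show ?thesis by (simp add: subset_mset.order_trans)
  qed
qed auto

lemma mset_merge_pairs: "mset (concat (merge_pairs lt xss)) \<subseteq># mset (concat xss)"
proof (induction lt xss rule: merge_pairs.induct)
  case (3 lt xs ys zss)
  then show ?case
    using subset_mset.add_mono[OF mset_merge_cancel[of lt xs ys] "3.IH"] by (simp add: ac_simps)
qed auto

lemma set_merge_cancel: "set (merge_cancel lt xs ys) \<subseteq> set xs \<union> set ys"
  by (induction lt xs ys rule: merge_cancel.induct) auto

lemma set_merge_pairs: "set (concat (merge_pairs lt xss)) \<subseteq> set (concat xss)"
  using set_mset_mono[OF mset_merge_pairs[of lt xss]] by simp

lemma distinct_mset_subset:
  assumes "mset xs \<subseteq># mset ys" "distinct ys"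
  shows "distinct xs"
proof -
  obtain zs where "mset ys = mset (xs @ zs)"
    using assms(1) by (metis ex_mset mset_append subset_mset.le_iff_add)
  then have "distinct (xs @ zs)"
    using assms(2) mset_eq_imp_distinct_iff by blast
  then show ?thesis by simp
qed

text \<open>An emitted head precedes the other head and hence, by transitivity, all that follows it;
  discarded heads impose nothing. Agreement of \<open>lt\<close> with \<open>R\<close> is asked only
  across the two runs, as elements of the same run are never compared.\<close>

lemma sorted_wrt_merge_cancel:
  assumes "transp_on A R" "set xs \<subseteq> A" "set ys \<subseteq> A"
    and "\<And>x y. x \<in> set xs \<Longrightarrow> y \<in> set ys \<Longrightarrow> (lt x y \<longleftrightarrow> R x y) \<and> (lt y x \<longleftrightarrow> R y x)"
    and "sorted_wrt R xs" "sorted_wrt R ys"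
  shows "sorted_wrt R (merge_cancel lt xs ys)"
  using assms(2-)
proof (induction lt xs ys rule: merge_cancel.induct)
  case (3 lt x xs y ys)
  have tr: "R a c" if "R a b" "R b c" "a \<in> A" "b \<in> A" "c \<in> A" for a b c
    using assms(1) that by (meson transp_onD)
  have xy: "lt x y = R x y" "lt y x = R y x"
    using "3.prems"(3) by auto
  have "x \<in> A" "y \<in> A"
    using "3.prems" by auto
  consider "R x y" | "\<not> R x y" "R y x" | "\<not> R x y" "\<not> R y x" by blast
  then show ?case
  proof cases
    case 1
    have "R x z" if "z \<in> set (merge_cancel lt xs (y # ys))" for z
      using that set_merge_cancel[of lt xs "y # ys"] "3.prems" 1 tr[of x y z] \<open>x \<in> A\<close> \<open>y \<in> A\<close>
      by (metis Un_iff list.set_intros(1) set_ConsD sorted_wrt.simps(2) subset_iff)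
    then show ?thesis
      using 1 xy "3.IH"(1) "3.prems" by auto
  next
    case 2
    have "R y z" if "z \<in> set (merge_cancel lt (x # xs) ys)" for z
      using that set_merge_cancel[of lt "x # xs" ys] "3.prems" 2 tr[of y x z] \<open>x \<in> A\<close> \<open>y \<in> A\<close>
      by (metis Un_iff list.set_intros(1) set_ConsD sorted_wrt.simps(2) subset_iff)
    then show ?thesis
      using 2 xy "3.IH"(2) "3.prems" by auto
  next
    case 3
    then show ?thesis
      using xy "3.IH"(3) "3.prems" by auto
  qed
qed auto

section \<open>The signed count against a chain, and the invariant of a round\<close>

definition balance :: "'a set \<Rightarrow> 'a list \<Rightarrow> int" where
  "balance C xs = (\<Sum>x\<leftarrow>xs. if x \<in> C then 1 else -1)"

lemma balance_simps [simp]: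
  "balance C [] = 0"
  "balance C (x # xs) = (if x \<in> C then 1 else -1) + balance C xs"
  "balance C (xs @ ys) = balance C xs + balance C ys"
  by (simp_all add: balance_def)

lemma balance_le_length: "balance C xs \<le> int (length xs)"
  by (induction xs) auto

text \<open>Two incomparable elements do not both lie in the chain \<open>C\<close>, so they contribute at most \<open>0\<close>.\<close>

lemma balance_merge_cancel:
  assumes "\<And>x y. x \<in> set xs \<Longrightarrow> y \<in> set ys \<Longrightarrow> x \<in> C \<Longrightarrow> y \<in> C \<Longrightarrow> lt x y \<or> lt y x"
  shows "balance C xs + balance C ys \<le> balance C (merge_cancel lt xs ys)"
  using assms
proof (induction lt xs ys rule: merge_cancel.induct)
  case (3 lt x xs y ys)
  have "x \<in> C \<Longrightarrow> y \<in> C \<Longrightarrow> lt x y \<or> lt y x"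
    using "3.prems" by simp
  then show ?case
    using "3.IH" "3.prems" by (cases "lt x y"; cases "lt y x") force+
qed auto

lemma balance_distinct:
  "distinct xs \<Longrightarrow> balance C xs = 2 * int (card (set xs \<inter> C)) - int (length xs)"
  by (induction xs) auto

text \<open>Distinctness concerns the concatenation, not single runs: it makes the heads of two runs
  different positions, and only on such pairs is the oracle specified.\<close>

definition chain_runs :: "'a set \<Rightarrow> ('a \<Rightarrow> 'a \<Rightarrow> bool) \<Rightarrow> 'a set \<Rightarrow> int \<Rightarrow> 'a list list \<Rightarrow> bool" where
  "chain_runs A R C b xss \<longleftrightarrow> distinct (concat xss) \<and> set (concat xss) \<subseteq> A \<and>
     (\<forall>xs \<in> set xss. sorted_wrt R xs) \<and> b \<le> balance C (concat xss)"

text \<open>\<open>lt\<close> is allowed to differ from \<open>R\<close> on the diagonal because the oracle is unspecified there.\<close>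

lemma chain_runs_merge_pairs:
  assumes R: "transp_on A R" "\<And>x y. x \<in> A \<Longrightarrow> y \<in> A \<Longrightarrow> x \<noteq> y \<Longrightarrow> lt x y \<longleftrightarrow> R x y"
    and C: "\<And>x y. x \<in> A \<inter> C \<Longrightarrow> y \<in> A \<inter> C \<Longrightarrow> x \<noteq> y \<Longrightarrow> R x y \<or> R y x"
    and "chain_runs A R C b xss"
  shows "chain_runs A R C b (merge_pairs lt xss)"
proof -
  have "(\<forall>xs \<in> set (merge_pairs lt xss). sorted_wrt R xs) \<and>
      balance C (concat xss) \<le> balance C (concat (merge_pairs lt xss))"
    if "distinct (concat xss)" "set (concat xss) \<subseteq> A" "\<forall>xs \<in> set xss. sorted_wrt R xs"
    using that R(2)
  proof (induction lt xss rule: merge_pairs.induct)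
    case (3 lt xs ys zss)
    have lt: "lt x y \<longleftrightarrow> R x y" "lt y x \<longleftrightarrow> R y x" "x \<noteq> y" "x \<in> A" "y \<in> A"
      if "x \<in> set xs" "y \<in> set ys" for x y
    proof -
      show "x \<noteq> y"
        using that "3.prems"(1) by auto
      moreover show "x \<in> A" "y \<in> A"
        using that "3.prems"(2) by auto
      ultimately show "lt x y \<longleftrightarrow> R x y" "lt y x \<longleftrightarrow> R y x"
        using "3.prems"(4) by auto
    qed
    have "sorted_wrt R (merge_cancel lt xs ys)"
      by (rule sorted_wrt_merge_cancel[OF R(1)]) (use "3.prems" lt in auto)
    moreover have "balance C xs + balance C ys \<le> balance C (merge_cancel lt xs ys)"
      by (rule balance_merge_cancel) (use lt C in blast)
    ultimately show ?case
      using "3.IH" "3.prems" by simp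
  qed auto
  moreover have "distinct (concat (merge_pairs lt xss))" if "distinct (concat xss)"
    using distinct_mset_subset[OF mset_merge_pairs that] .
  moreover note set_merge_pairs[of lt xss]
  ultimately show ?thesis
    using assms(4) unfolding chain_runs_def by (meson order_trans)
qed

subsection \<open>The program\<close>

definition move_head :: "string \<Rightarrow> com" where
  "move_head i = Seq (Store ''B'' (Reg ''p'') (Arr ''out'' (Reg i)))
     (Seq (Assign i (Plus (Reg i) (Num 1))) (Assign ''p'' (Plus (Reg ''p'') (Num 1))))"

definition merge_step :: com where
  "merge_step =
     Cond (Less (Reg ''i'') (Reg ''e''))
       (Cond (Less (Reg ''j'') (Reg ''f''))
         (Seq (Query ''x'' (Arr ''out'' (Reg ''i'')) (Arr ''out'' (Reg ''j'')))
           (Cond (Reg ''x'') (move_head ''i'')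
             (Seq (Query ''x'' (Arr ''out'' (Reg ''j'')) (Arr ''out'' (Reg ''i'')))
               (Cond (Reg ''x'') (move_head ''j'')
                 (Seq (Assign ''i'' (Plus (Reg ''i'') (Num 1)))
                   (Assign ''j'' (Plus (Reg ''j'') (Num 1))))))))
         (move_head ''i''))
       (move_head ''j'')"

text \<open>The sum of the two truth values serves as their disjunction; its value 2 has to fit into
  a word.\<close>

definition merge_loop :: com where
  "merge_loop =
     While (Plus (Less (Reg ''i'') (Reg ''e'')) (Less (Reg ''j'') (Reg ''f''))) merge_step"

section \<open>Verification of the merge of two runs\<close>

lemma written_merge_step:
  "written_regs merge_step = {''i'', ''j'', ''p'', ''x''}" "written_arrs merge_step = {''B''}"
  by (auto simp: merge_step_def move_head_def)

text \<open>The dearest iteration that consumes a single element makes two queries and one move: 34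
  units, plus 8 for the guard, which 50 covers. The additive 10 covers the guard that fails.\<close>

lemma wp_merge_loop:
  assumes W: "n + 2 \<le> W"
    and ef: "regs s0 ''i'' \<le> regs s0 ''e''" "regs s0 ''j'' \<le> regs s0 ''f''"
      "regs s0 ''e'' \<le> n" "regs s0 ''f'' \<le> n"
    and p: "regs s0 ''p'' + (regs s0 ''e'' - regs s0 ''i'') + (regs s0 ''f'' - regs s0 ''j'') \<le> n"
    and elems: "\<And>u. u < regs s0 ''e'' \<or> u < regs s0 ''f'' \<Longrightarrow> arrs s0 ''out'' u < n"
    and final: "\<And>s t. unchanged merge_step s0 s \<Longrightarrow>
      map (arrs s ''B'') [0..<regs s ''p''] = map (arrs s0 ''B'') [0..<regs s0 ''p''] @
        merge_cancel orc (map (arrs s0 ''out'') [regs s0 ''i''..<regs s0 ''e''])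
          (map (arrs s0 ''out'') [regs s0 ''j''..<regs s0 ''f'']) \<Longrightarrow>
      t \<le> 50 * ((regs s0 ''e'' - regs s0 ''i'') + (regs s0 ''f'' - regs s0 ''j'')) + 10 \<Longrightarrow> R s t"
  shows "wp W orc merge_loop s0 R"
proof -
  define A e f where "A = arrs s0 ''out''" and "e = regs s0 ''e''" and "f = regs s0 ''f''"
  have same: "arrs s ''out'' = A" "regs s ''e'' = e" "regs s ''f'' = f"
    if "unchanged merge_step s0 s" for s
    using that by (auto simp: unchanged_def written_merge_step A_def e_def f_def)
  define zs where "zs = map (arrs s0 ''B'') [0..<regs s0 ''p''] @
      merge_cancel orc (map A [regs s0 ''i''..<e]) (map A [regs s0 ''j''..<f])"
  \<comment> \<open>The part already written, followed by the merge of what is left, stays equal to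
    \<open>zs\<close>; each branch of the step is then one equation of \<open>merge_cancel\<close>.
    The inequality with \<open>n\<close> keeps the write position in the word range.\<close>
  define I where "I s \<longleftrightarrow> regs s ''i'' \<le> e \<and> regs s ''j'' \<le> f \<and>
      regs s ''p'' + (e - regs s ''i'') + (f - regs s ''j'') \<le> n \<and>
      map (arrs s ''B'') [0..<regs s ''p''] @
        merge_cancel orc (map A [regs s ''i''..<e]) (map A [regs s ''j''..<f]) = zs" for s :: state
  show ?thesis
    unfolding merge_loop_def
  proof (rule wp_While[where I = I and
        \<Phi> = "\<lambda>s. 50 * ((e - regs s ''i'') + (f - regs s ''j''))"])
    show "I s0"
      using ef p unfolding I_def zs_def e_def f_def A_def by simp
  next
    fix s assume s: "unchanged merge_step s0 s" "I s"
    then show "fits W (Plus (Less (Reg ''i'') (Reg ''e'')) (Less (Reg ''j'') (Reg ''f''))) s"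
      using W ef unfolding I_def by (auto simp: same[OF s(1)] e_def[symmetric] f_def[symmetric])
  next
    fix s t assume s: "unchanged merge_step s0 s" "I s"
      and "val (Plus (Less (Reg ''i'') (Reg ''e'')) (Less (Reg ''j'') (Reg ''f''))) s = 0"
      and t: "t + 50 * (e - regs s ''i'' + (f - regs s ''j''))
         \<le> 50 * (e - regs s0 ''i'' + (f - regs s0 ''j'')) + 1 +
            cost (Plus (Less (Reg ''i'') (Reg ''e'')) (Less (Reg ''j'') (Reg ''f'')))"
    then have ij: "regs s ''i'' = e" "regs s ''j'' = f"
      by (auto simp: same[OF s(1)] I_def split: if_splits)
    show "R s t"
    proof (rule final[OF s(1), folded A_def e_def f_def])
    qed (use s(2) t ij in \<open>simp_all add: I_def zs_def\<close>)
  next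
    fix s assume s: "unchanged merge_step s0 s" "I s"
      and c: "val (Plus (Less (Reg ''i'') (Reg ''e'')) (Less (Reg ''j'') (Reg ''f''))) s \<noteq> 0"
    define i j where "i = regs s ''i''" and "j = regs s ''j''"
    have ij: "i < e \<or> j < f" "i \<le> e" "j \<le> f" "e \<le> n" "f \<le> n"
      using c s(2) ef by (auto simp: same[OF s(1)] I_def i_def j_def e_def[symmetric] f_def[symmetric]
          split: if_splits)
    have p': "regs s ''p'' + (e - i) + (f - j) \<le> n"
      using s by (auto simp: I_def i_def j_def)
    have zs: "map (arrs s ''B'') [0..<regs s ''p''] @
        merge_cancel orc (map A [i..<e]) (map A [j..<f]) = zs"
      using s by (auto simp: I_def i_def j_def)
    have A: "u < e \<or> u < f \<Longrightarrow> A u \<le> W" for u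
      using elems[of u] W by (auto simp: A_def e_def f_def)
    note defs = merge_step_def move_head_def wp_simps I_def same[OF s(1)]
      i_def[symmetric] j_def[symmetric]
    have i: "[i..<e] = i # [Suc i..<e]" if "i < e"
      using that by (rule upt_conv_Cons)
    have j: "[j..<f] = j # [Suc j..<f]" if "j < f"
      using that by (rule upt_conv_Cons)
    consider "i < e" "j < f" "orc (A i) (A j)" |
      "i < e" "j < f" "\<not> orc (A i) (A j)" "orc (A j) (A i)" |
      "i < e" "j < f" "\<not> orc (A i) (A j)" "\<not> orc (A j) (A i)" |
      "i < e" "\<not> j < f" | "\<not> i < e" "j < f"
      using ij by blast
    then show "wp W orc merge_step s (\<lambda>s' t. I s' \<and>
        50 * (e - regs s' ''i'' + (f - regs s' ''j'')) + t + 1 +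
          cost (Plus (Less (Reg ''i'') (Reg ''e'')) (Less (Reg ''j'') (Reg ''f'')))
        \<le> 50 * (e - regs s ''i'' + (f - regs s ''j'')))"
    proof cases
      case 1
      then show ?thesis using W ij p' A zs i j by (simp add: defs) linarith
    next
      case 2
      then show ?thesis using W ij p' A zs i j by (simp add: defs) linarith
    next
      case 3
      then show ?thesis using W ij p' A zs i j by (simp add: defs) linarith
    next
      case 4
      then show ?thesis using W ij p' A zs i by (simp add: defs) linarith
    next
      case 5
      then show ?thesis using W ij p' A zs j by (simp add: defs) linarith
    qed
  qed
qed

text \<open>
  The current runs are stored consecutively in \<open>out\<close>, their lengths in \<open>L\<close>.  The runs number \<open>r\<close>
  and \<open>r + 1\<close> of \<open>out\<close> are merged into \<open>B\<close>; the length of the result overwrites an entry of \<open>L\<close>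
  that is no longer needed, as \<open>h = r / 2\<close>.  In \<open>merge_round\<close> the entry \<open>L[m] = 0\<close> provides an
  empty partner for the last run if \<open>m\<close> is odd.
\<close>

definition merge_pair :: com where
  "merge_pair =
     Seq (Assign ''i'' (Reg ''f''))
     (Seq (Assign ''e'' (Plus (Reg ''i'') (Arr ''L'' (Reg ''r''))))
     (Seq (Assign ''j'' (Reg ''e''))
     (Seq (Assign ''f'' (Plus (Reg ''j'') (Arr ''L'' (Plus (Reg ''r'') (Num 1)))))
     (Seq (Assign ''q'' (Reg ''p''))
     (Seq merge_loop
     (Seq (Store ''L'' (Reg ''h'') (Minus (Reg ''p'') (Reg ''q'')))
     (Seq (Assign ''h'' (Plus (Reg ''h'') (Num 1)))
       (Assign ''r'' (Plus (Reg ''r'') (Num 2))))))))))"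

lemma written_merge_pair:
  "written_regs merge_pair = {''i'', ''e'', ''j'', ''f'', ''q'', ''p'', ''x'', ''h'', ''r''}"
  "written_arrs merge_pair = {''B'', ''L''}"
  by (auto simp: merge_pair_def merge_loop_def written_merge_step)

text \<open>On entry \<open>f\<close> holds the end of the preceding pair, which is where
  \<open>xs\<close> starts. Cancellation can only make the output lag behind the input, hence
  \<open>p \<le> a\<close>; this keeps \<open>p\<close> in the word range.\<close>

lemma wp_merge_pair:
  assumes W: "n + 2 \<le> W"
    and regs: "regs s0 ''r'' = r" "regs s0 ''h'' = h" "regs s0 ''f'' = a" "regs s0 ''p'' = p"
    and le: "r < n" "h \<le> r" "p \<le> a" "a + length xs + length ys \<le> n"
    and L: "arrs s0 ''L'' r = length xs" "arrs s0 ''L'' (Suc r) = length ys"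
    and A: "map (arrs s0 ''out'') [a..<a + length xs] = xs"
      "map (arrs s0 ''out'') [a + length xs..<a + length xs + length ys] = ys"
    and elems: "\<And>u. u < a + length xs + length ys \<Longrightarrow> arrs s0 ''out'' u < n"
  shows "wp W orc merge_pair s0 (\<lambda>s t. regs s ''r'' = r + 2 \<and> regs s ''h'' = h + 1 \<and>
    regs s ''f'' = a + length xs + length ys \<and>
    regs s ''p'' = p + length (merge_cancel orc xs ys) \<and>
    map (arrs s ''B'') [0..<regs s ''p''] =
      map (arrs s0 ''B'') [0..<p] @ merge_cancel orc xs ys \<and>
    arrs s ''L'' = (arrs s0 ''L'')(h := length (merge_cancel orc xs ys)) \<and>
    t \<le> 50 * (length xs + length ys) + 60)"
proof -
  define s1 where "s1 = s0\<lparr>regs := (regs s0)(''i'' := a, ''e'' := a + length xs,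
    ''j'' := a + length xs, ''f'' := a + length xs + length ys, ''q'' := p)\<rparr>"
  have "wp W orc merge_loop s1 (\<lambda>s t. unchanged merge_step s1 s \<and>
    map (arrs s ''B'') [0..<regs s ''p''] =
      map (arrs s0 ''B'') [0..<p] @ merge_cancel orc xs ys \<and>
    t \<le> 50 * (length xs + length ys) + 10)"
  proof (rule wp_merge_loop[OF W])
    fix u assume "u < regs s1 ''e'' \<or> u < regs s1 ''f''"
    then show "arrs s1 ''out'' u < n"
      using elems by (auto simp: s1_def)
  qed (use regs le A in \<open>simp_all add: s1_def unchanged_def\<close>)
  then have "wp W orc merge_loop s1 (\<lambda>s t. regs s ''r'' = r \<and> regs s ''h'' = h \<and>
    regs s ''q'' = p \<and> regs s ''f'' = a + length xs + length ys \<and>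
    arrs s ''L'' = arrs s0 ''L'' \<and> regs s ''p'' = p + length (merge_cancel orc xs ys) \<and>
    map (arrs s ''B'') [0..<regs s ''p''] =
      map (arrs s0 ''B'') [0..<p] @ merge_cancel orc xs ys \<and>
    t \<le> 50 * (length xs + length ys) + 10)"
  proof (rule wp_mono, elim conjE)
    fix s :: state and t
    assume B: "map (arrs s ''B'') [0..<regs s ''p''] =
      map (arrs s0 ''B'') [0..<p] @ merge_cancel orc xs ys"
    have "regs s ''p'' = p + length (merge_cancel orc xs ys)"
      using arg_cong[OF B, of length] by simp
    moreover assume "unchanged merge_step s1 s" "t \<le> 50 * (length xs + length ys) + 10"
    ultimately show "regs s ''r'' = r \<and> regs s ''h'' = h \<and>
      regs s ''q'' = p \<and> regs s ''f'' = a + length xs + length ys \<and>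
      arrs s ''L'' = arrs s0 ''L'' \<and> regs s ''p'' = p + length (merge_cancel orc xs ys) \<and>
      map (arrs s ''B'') [0..<regs s ''p''] =
        map (arrs s0 ''B'') [0..<p] @ merge_cancel orc xs ys \<and>
      t \<le> 50 * (length xs + length ys) + 10"
      using B by (simp add: unchanged_def written_merge_step regs s1_def)
  qed
  then show ?thesis
    unfolding merge_pair_def wp_simps
    using W regs le L length_merge_cancel[of orc xs ys]
    by (simp add: s1_def[symmetric] regs) (elim wp_mono, elim conjE, simp)
qed

definition merge_round :: com where
  "merge_round =
     Seq (Store ''L'' (Reg ''m'') (Num 0))
     (Seq (Assign ''r'' (Num 0))
     (Seq (Assign ''h'' (Num 0))
     (Seq (Assign ''p'' (Num 0))
     (Seq (Assign ''f'' (Num 0))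
     (Seq (While (Less (Reg ''r'') (Reg ''m'')) merge_pair)
     (Seq (Assign ''i'' (Num 0))
     (Seq (While (Less (Reg ''i'') (Reg ''p''))
       (Seq (Store ''out'' (Reg ''i'') (Arr ''B'' (Reg ''i'')))
         (Assign ''i'' (Plus (Reg ''i'') (Num 1)))))
       (Assign ''m'' (Reg ''h'')))))))))"

text \<open>\<open>p\<close> is set before the rounds because for \<open>n \<le> 1\<close> none is
  run, and the length of the result is read from \<open>p\<close>.\<close>

definition merge_sort :: com where
  "merge_sort =
     Seq (While (Less (Reg ''i'') (Reg ''n''))
       (Seq (Store ''out'' (Reg ''i'') (Reg ''i''))
         (Seq (Store ''L'' (Reg ''i'') (Num 1))
           (Assign ''i'' (Plus (Reg ''i'') (Num 1))))))
     (Seq (Assign ''m'' (Reg ''n''))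
     (Seq (Assign ''p'' (Reg ''n''))
       (While (Less (Num 1) (Reg ''m'')) merge_round)))"

section \<open>Verification of a whole round\<close>

lemma map_upt_eq_append:
  assumes "map g [a..<b] = xs @ ys" "a \<le> b"
  shows "b = a + length xs + length ys" "map g [a..<a + length xs] = xs"
    "map g [a + length xs..<b] = ys"
proof -
  show b: "b = a + length xs + length ys"
    using arg_cong[OF assms(1), of length] assms(2) by simp
  have "[a..<b] = [a..<a + length xs] @ [a + length xs..<b]"
    using b by (metis le_add1 upt_add_eq_append add.assoc)
  then have "map g [a..<a + length xs] @ map g [a + length xs..<b] = xs @ ys"
    using assms(1) by (metis map_append)
  then show "map g [a..<a + length xs] = xs" "map g [a + length xs..<b] = ys"
    by simp_all
qed

text \<open>Each unread element is budgeted 50 units for merging and each unread run 100 for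
  overhead. For an odd number of runs the last iteration lowers the truncated difference
  \<open>length xss - r\<close> by 1 only, so a single run must pay for the 60 units of overhead and
  the 4 of the guard.\<close>

lemma wp_pair_loop:
  assumes W: "n + 2 \<le> W" and m: "regs s0 ''m'' = length xss" "length xss \<le> n"
    and regs: "regs s0 ''r'' = 0" "regs s0 ''h'' = 0" "regs s0 ''f'' = 0" "regs s0 ''p'' = 0"
    and L: "map (arrs s0 ''L'') [0..<length xss] = map length xss"
      "arrs s0 ''L'' (length xss) = 0"
    and A: "map (arrs s0 ''out'') [0..<N] = concat xss" "set (concat xss) \<subseteq> {..<n}" "N \<le> n"
  shows "wp W orc (While (Less (Reg ''r'') (Reg ''m'')) merge_pair) s0 (\<lambda>s t.
    unchanged merge_pair s0 s \<and>
    regs s ''h'' = length (merge_pairs orc xss) \<and>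
    regs s ''p'' = length (concat (merge_pairs orc xss)) \<and>
    map (arrs s ''L'') [0..<regs s ''h''] = map length (merge_pairs orc xss) \<and>
    map (arrs s ''B'') [0..<regs s ''p''] = concat (merge_pairs orc xss) \<and>
    t \<le> 50 * N + 100 * length xss + 10)"
proof -
  \<comment> \<open>\<open>ds\<close> are the finished runs and \<open>rs\<close> the unread ones;
    \<open>L\<close> holds the lengths of both. As \<open>h \<le> r\<close>, storing at
    \<open>h\<close> spares the unread entries from \<open>r + 2\<close> on and the sentinel 0 at
    \<open>length xss\<close>. An odd number of runs lets \<open>r\<close> end one beyond
    it.\<close>
  define I where "I s \<longleftrightarrow> (\<exists>ds rs.
      regs s ''r'' = 2 * regs s ''h'' \<and> regs s ''p'' \<le> regs s ''f'' \<and> regs s ''f'' \<le> N \<and>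
      regs s ''h'' = length ds \<and> regs s ''p'' = length (concat ds) \<and>
      arrs s ''L'' (length xss) = 0 \<and>
      map (arrs s ''L'') [regs s ''r''..<length xss] = map length rs \<and>
      map (arrs s0 ''out'') [regs s ''f''..<N] = concat rs \<and>
      map (arrs s ''L'') [0..<regs s ''h''] = map length ds \<and>
      map (arrs s ''B'') [0..<regs s ''p''] = concat ds \<and>
      ds @ merge_pairs orc rs = merge_pairs orc xss \<and> regs s ''r'' \<le> Suc (length xss))" for s :: state
  have same: "arrs s ''out'' = arrs s0 ''out''" "regs s ''m'' = length xss"
    if "unchanged merge_pair s0 s" for s
    using that m by (auto simp: unchanged_def written_merge_pair)
  have elems: "arrs s0 ''out'' u < n" if "u < N" for u
  proof -
    have "arrs s0 ''out'' u \<in> set (map (arrs s0 ''out'') [0..<N])"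
      using that by simp
    then show ?thesis using A by (metis lessThan_iff subsetD)
  qed
  show ?thesis
  proof (rule wp_While[where I = I and
        \<Phi> = "\<lambda>s. 50 * (N - regs s ''f'') + 100 * (length xss - regs s ''r'')"])
    show "I s0"
      unfolding I_def using regs L A by - (rule exI[of _ "[]"], rule exI[of _ xss], simp)
  next
    fix s assume "unchanged merge_pair s0 s" "I s"
    then show "fits W (Less (Reg ''r'') (Reg ''m'')) s"
      using W m same unfolding I_def by auto
  next
    fix s t assume s: "unchanged merge_pair s0 s" "I s"
      and "val (Less (Reg ''r'') (Reg ''m'')) s = 0"
      and t: "t + (50 * (N - regs s ''f'') + 100 * (length xss - regs s ''r''))
        \<le> 50 * (N - regs s0 ''f'') + 100 * (length xss - regs s0 ''r'') + 1 +
           cost (Less (Reg ''r'') (Reg ''m''))"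
    then have r: "length xss \<le> regs s ''r''"
      by (auto simp: same split: if_splits)
    then show "unchanged merge_pair s0 s \<and>
      regs s ''h'' = length (merge_pairs orc xss) \<and>
      regs s ''p'' = length (concat (merge_pairs orc xss)) \<and>
      map (arrs s ''L'') [0..<regs s ''h''] = map length (merge_pairs orc xss) \<and>
      map (arrs s ''B'') [0..<regs s ''p''] = concat (merge_pairs orc xss) \<and>
      t \<le> 50 * N + 100 * length xss + 10"
    proof -
      obtain ds rs where "map (arrs s ''L'') [regs s ''r''..<length xss] = map length rs"
        "regs s ''h'' = length ds" "regs s ''p'' = length (concat ds)"
        "map (arrs s ''L'') [0..<regs s ''h''] = map length ds"
        "map (arrs s ''B'') [0..<regs s ''p''] = concat ds"
        "ds @ merge_pairs orc rs = merge_pairs orc xss"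
        using s(2) unfolding I_def by (elim exE conjE) (rule that)
      with r s(1) t regs show ?thesis by simp
    qed
  next
    fix s assume s: "unchanged merge_pair s0 s" "I s"
      and c: "val (Less (Reg ''r'') (Reg ''m'')) s \<noteq> 0"
    define r h a p where "r = regs s ''r''" and "h = regs s ''h''"
      and "a = regs s ''f''" and "p = regs s ''p''"
    note rhap = r_def[symmetric] h_def[symmetric] a_def[symmetric] p_def[symmetric]
    have r: "r < length xss"
      using c s by (simp add: same r_def split: if_splits)
    obtain ds rs where I: "r = 2 * h" "p \<le> a" "a \<le> N" "h = length ds" "p = length (concat ds)"
      "arrs s ''L'' (length xss) = 0" "map (arrs s ''L'') [r..<length xss] = map length rs"
      "map (arrs s0 ''out'') [a..<N] = concat rs" "map (arrs s ''L'') [0..<h] = map length ds"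
      "map (arrs s ''B'') [0..<p] = concat ds" "ds @ merge_pairs orc rs = merge_pairs orc xss"
      "r \<le> Suc (length xss)"
      using s(2) unfolding I_def rhap by (elim exE conjE) (rule that)
    obtain xs ys zss where xyz: "concat rs = xs @ ys @ concat zss"
      "merge_pairs orc rs = merge_cancel orc xs ys # merge_pairs orc zss"
      "arrs s ''L'' r = length xs" "arrs s ''L'' (Suc r) = length ys"
      "map (arrs s ''L'') [r + 2..<length xss] = map length zss"
    proof -
      from I(7) upt_conv_Cons[OF r] obtain xs rs' where 1: "rs = xs # rs'"
        "arrs s ''L'' r = length xs" "map (arrs s ''L'') [Suc r..<length xss] = map length rs'"
        by auto
      show ?thesis
      proof (cases rs')
        \<comment> \<open>The unpaired last run is merged with the empty run whose length 0 is the
          sentinel entry.\<close>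
        case Nil
        then have "Suc r = length xss" using 1(3) r by auto
        then show ?thesis using 1 Nil I(6) that[of xs "[]" "[]"] by simp
      next
        case (Cons ys zss)
        then have "[Suc r..<length xss] \<noteq> []" using 1(3) by auto
        then have "Suc r < length xss" by simp
        from 1 Cons upt_conv_Cons[OF this] show ?thesis
          by (intro that[of xs ys zss]) auto
      qed
    qed
    have N: "N = a + length xs + length ys + length (concat zss)"
      and xs: "map (arrs s0 ''out'') [a..<a + length xs] = xs"
      and yzs: "map (arrs s0 ''out'') [a + length xs..<N] = ys @ concat zss"
      using map_upt_eq_append[of "arrs s0 ''out''" a N xs "ys @ concat zss"] I xyz by auto
    have ys: "map (arrs s0 ''out'') [a + length xs..<a + length xs + length ys] = ys"
      and zss: "map (arrs s0 ''out'') [a + length xs + length ys..<N] = concat zss"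
      using map_upt_eq_append[OF yzs] N by auto
    show "wp W orc merge_pair s (\<lambda>s' t. I s' \<and>
      50 * (N - regs s' ''f'') + 100 * (length xss - regs s' ''r'') + t + 1 +
        cost (Less (Reg ''r'') (Reg ''m''))
      \<le> 50 * (N - regs s ''f'') + 100 * (length xss - regs s ''r''))"
    proof (rule wp_mono[OF wp_merge_pair[OF W, of s r h a p xs ys orc]])
      fix s' :: state and t
      let ?z = "merge_cancel orc xs ys"
      assume *: "regs s' ''r'' = r + 2 \<and> regs s' ''h'' = h + 1 \<and>
        regs s' ''f'' = a + length xs + length ys \<and> regs s' ''p'' = p + length ?z \<and>
        map (arrs s' ''B'') [0..<regs s' ''p''] = map (arrs s ''B'') [0..<p] @ ?z \<and>
        arrs s' ''L'' = (arrs s ''L'')(h := length ?z) \<and>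
        t \<le> 50 * (length xs + length ys) + 60"
      have "I s'"
        unfolding I_def
        by (rule exI[of _ "ds @ [?z]"], rule exI[of _ zss],
          use * I xyz N zss r length_merge_cancel[of orc xs ys] in \<open>elim conjE, simp\<close>)
      moreover have "50 * (N - regs s' ''f'') + 100 * (length xss - regs s' ''r'') + t + 1 +
        cost (Less (Reg ''r'') (Reg ''m''))
          \<le> 50 * (N - regs s ''f'') + 100 * (length xss - regs s ''r'')"
        using * N r by (simp add: rhap) linarith
      ultimately show "I s' \<and>
      50 * (N - regs s' ''f'') + 100 * (length xss - regs s' ''r'') + t + 1 +
        cost (Less (Reg ''r'') (Reg ''m''))
      \<le> 50 * (N - regs s ''f'') + 100 * (length xss - regs s ''r'')" ..
    qed (use I r m A(3) xyz N xs ys elems same[OF s(1)] in \<open>simp_all add: rhap\<close>)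
  qed
qed

text \<open>Cells beyond the stored runs are left unspecified, so remains of earlier rounds do no
  harm. The number of runs is bounded separately, since empty runs are not counted by the number of
  elements.\<close>

definition holds_runs :: "nat \<Rightarrow> nat list list \<Rightarrow> state \<Rightarrow> bool" where
  "holds_runs n xss s \<longleftrightarrow> regs s ''m'' = length xss \<and> length xss \<le> n \<and>
     regs s ''p'' = length (concat xss) \<and> length (concat xss) \<le> n \<and>
     map (arrs s ''L'') [0..<length xss] = map length xss \<and>
     map (arrs s ''out'') [0..<length (concat xss)] = concat xss \<and>
     set (concat xss) \<subseteq> {..<n}"

lemma wp_copy_loop:
  assumes "n + 2 \<le> W" "regs s0 ''p'' \<le> n" "regs s0 ''i'' = 0"
    and elems: "\<And>u. u < regs s0 ''p'' \<Longrightarrow> arrs s0 ''B'' u < n"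
    and final: "\<And>s t. regs s = (regs s0)(''i'' := regs s0 ''p'') \<Longrightarrow>
      arrs s ''L'' = arrs s0 ''L'' \<Longrightarrow>
      map (arrs s ''out'') [0..<regs s0 ''p''] = map (arrs s0 ''B'') [0..<regs s0 ''p''] \<Longrightarrow>
      t \<le> 20 * n + 10 \<Longrightarrow> R s t"
  shows "wp W orc (While (Less (Reg ''i'') (Reg ''p''))
     (Seq (Store ''out'' (Reg ''i'') (Arr ''B'' (Reg ''i'')))
       (Assign ''i'' (Plus (Reg ''i'') (Num 1))))) s0 R"
proof (rule wp_While[where \<Phi> = "\<lambda>s. 20 * (regs s0 ''p'' - regs s ''i'')" and
      I = "\<lambda>s. regs s ''i'' \<le> regs s0 ''p'' \<and> map (arrs s ''out'') [0..<regs s ''i''] =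
        map (arrs s0 ''B'') [0..<regs s ''i'']"], goal_cases)
  case (3 s)
  then have "arrs s ''B'' (regs s ''i'') \<le> W" if "regs s ''i'' < regs s0 ''p''"
    using assms(1) elems[OF that] by (simp add: unchanged_def)
  with 3 assms show ?case by (simp add: wp_simps unchanged_def split: if_splits)
next
  case (4 s t)
  have i: "regs s ''i'' = regs s0 ''p''"
    using 4 by (auto simp: unchanged_def split: if_splits)
  show ?case
  proof (rule final)
    show "regs s = (regs s0)(''i'' := regs s0 ''p'')"
      using 4(1) i by (auto simp: unchanged_def)
  qed (use 4 i assms in \<open>auto simp: unchanged_def\<close>)
qed (use assms in \<open>auto simp: unchanged_def\<close>)

text \<open>A round takes 50 units per element for merging, 100 per run for overhead and 20 per
  element for copying back, at most \<open>170 * n\<close> plus a constant.\<close>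

lemma wp_merge_round:
  assumes W: "n + 2 \<le> W" and runs: "holds_runs n xss s"
  shows "wp W orc merge_round s (\<lambda>s' t. holds_runs n (merge_pairs orc xss) s' \<and> t \<le> 200 * n + 60)"
proof -
  let ?zss = "merge_pairs orc xss"
  define s1 where "s1 = s\<lparr>arrs := (arrs s)(''L'' := (arrs s ''L'')(length xss := 0)),
    regs := (regs s)(''r'' := 0, ''h'' := 0, ''p'' := 0, ''f'' := 0)\<rparr>"
  have n: "length xss \<le> n" "length (concat xss) \<le> n" and set: "set (concat xss) \<subseteq> {..<n}"
    using runs unfolding holds_runs_def by blast+
  have len: "length ?zss \<le> n" "length (concat ?zss) \<le> n"
    using n size_mset_mono[OF mset_merge_pairs[of orc xss]] by (simp_all add: length_merge_pairs)
  have set_z: "set (concat ?zss) \<subseteq> {..<n}"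
    using set set_merge_pairs[of orc xss] by (rule order_trans[rotated])
  have "wp W orc (While (Less (Reg ''r'') (Reg ''m'')) merge_pair) s1
    (\<lambda>s t. unchanged merge_pair s1 s \<and> regs s ''h'' = length ?zss \<and>
      regs s ''p'' = length (concat ?zss) \<and>
      map (arrs s ''L'') [0..<regs s ''h''] = map length ?zss \<and>
      map (arrs s ''B'') [0..<regs s ''p''] = concat ?zss \<and>
      t \<le> 50 * length (concat xss) + 100 * length xss + 10)"
    by (rule wp_pair_loop[OF W]) (use runs in \<open>simp_all add: s1_def holds_runs_def\<close>)
  \<comment> \<open>49 is 60 less the 11 units of the store and the four assignments that precede
    the loop.\<close>
  then have "wp W orc (While (Less (Reg ''r'') (Reg ''m'')) merge_pair) s1
    (\<lambda>s t. wp W orc (Assign ''i'' (Num 0)) s (\<lambda>s t'. wp W orc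
      (While (Less (Reg ''i'') (Reg ''p''))
        (Seq (Store ''out'' (Reg ''i'') (Arr ''B'' (Reg ''i'')))
          (Assign ''i'' (Plus (Reg ''i'') (Num 1))))) s
      (\<lambda>s t''. wp W orc (Assign ''m'' (Reg ''h'')) s (\<lambda>s t'''.
        holds_runs n ?zss s \<and> t + (t' + (t'' + t''')) \<le> 200 * n + 49))))"
  proof (rule wp_mono, elim conjE)
    fix s :: state and t
    assume *: "regs s ''h'' = length ?zss" "regs s ''p'' = length (concat ?zss)"
      "map (arrs s ''L'') [0..<regs s ''h''] = map length ?zss"
      and B: "map (arrs s ''B'') [0..<regs s ''p''] = concat ?zss"
      and t: "t \<le> 50 * length (concat xss) + 100 * length xss + 10"
    have elems: "arrs s ''B'' u < n" if "u < regs s ''p''" for u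
    proof -
      have "arrs s ''B'' u \<in> set (map (arrs s ''B'') [0..<regs s ''p''])"
        using that by simp
      then show ?thesis using B set_z by (metis lessThan_iff subsetD)
    qed
    let ?s = "set_reg ''i'' 0 s"
    have "wp W orc (While (Less (Reg ''i'') (Reg ''p''))
        (Seq (Store ''out'' (Reg ''i'') (Arr ''B'' (Reg ''i'')))
          (Assign ''i'' (Plus (Reg ''i'') (Num 1))))) ?s
      (\<lambda>s' t''. wp W orc (Assign ''m'' (Reg ''h'')) s' (\<lambda>s' t'''.
        holds_runs n ?zss s' \<and> t + (2 + (t'' + t''')) \<le> 200 * n + 49))"
    proof (rule wp_copy_loop[OF W], goal_cases)
      case (4 s' t')
      then show ?case
        using * B t n len set_z W by (simp add: wp_simps holds_runs_def del: map_eq_conv)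
    qed (use * elems len in auto)
    then show "wp W orc (Assign ''i'' (Num 0)) s (\<lambda>s t'. wp W orc
      (While (Less (Reg ''i'') (Reg ''p''))
        (Seq (Store ''out'' (Reg ''i'') (Arr ''B'' (Reg ''i'')))
          (Assign ''i'' (Plus (Reg ''i'') (Num 1))))) s
      (\<lambda>s t''. wp W orc (Assign ''m'' (Reg ''h'')) s (\<lambda>s t'''.
        holds_runs n ?zss s \<and> t + (t' + (t'' + t''')) \<le> 200 * n + 49)))"
      by (simp add: wp_Assign)
  qed
  moreover have "regs s ''m'' = length xss"
    using runs by (simp add: holds_runs_def)
  ultimately show ?thesis
    unfolding merge_round_def
    using W n by (simp add: wp_Seq wp_Store wp_Assign s1_def[symmetric])
qed

text \<open>An arbitrary property \<open>Q\<close> that survives rounds keeps the order theory out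
  of the program verification. Every round is charged for \<open>n\<close> elements, however many
  have been discarded.\<close>

lemma wp_merge_sort:
  assumes W: "n + 2 \<le> W" and s0: "regs s0 ''n'' = n" "regs s0 ''i'' = 0"
    and Q: "Q (map (\<lambda>i. [i]) [0..<n])" "\<And>xss. Q xss \<Longrightarrow> Q (merge_pairs orc xss)"
  shows "wp W orc merge_sort s0 (\<lambda>s t. (\<exists>xss. Q xss \<and> length xss \<le> 1 \<and> holds_runs n xss s) \<and>
    t \<le> 20 * n + (200 * n + 70) * ceillog2 n + 30)"
proof -
  define init where "init = Seq (Store ''out'' (Reg ''i'') (Reg ''i''))
         (Seq (Store ''L'' (Reg ''i'') (Num 1))
           (Assign ''i'' (Plus (Reg ''i'') (Num 1))))"
  have loop: "wp W orc (While (Less (Num 1) (Reg ''m'')) merge_round) s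
      (\<lambda>s t. (\<exists>xss. Q xss \<and> length xss \<le> 1 \<and> holds_runs n xss s) \<and>
        t \<le> (200 * n + 70) * ceillog2 n + 10)"
    if s: "holds_runs n (map (\<lambda>i. [i]) [0..<n]) s" for s
  proof (rule wp_While[where I = "\<lambda>s. \<exists>xss. Q xss \<and> holds_runs n xss s" and
        \<Phi> = "\<lambda>s. (200 * n + 70) * ceillog2 (regs s ''m'')"], goal_cases)
    case 1
    then show ?case using s Q(1) by blast
  next
    case (2 s)
    then show ?case using W by (auto simp: holds_runs_def)
  next
    case (3 s)
    then obtain xss where xss: "Q xss" "holds_runs n xss s" by blast
    have m: "regs s ''m'' = length xss" "1 < length xss"
      using xss 3 by (auto simp: holds_runs_def split: if_splits)
    show ?case
    proof (rule wp_mono[OF wp_merge_round[OF W xss(2)]], elim conjE)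
      fix s' :: state and t
      assume "holds_runs n (merge_pairs orc xss) s'" "t \<le> 200 * n + 60"
      moreover from this(1) have "regs s' ''m'' = (length xss + 1) div 2"
        by (simp add: holds_runs_def length_merge_pairs)
      \<comment> \<open>Halving with rounding up lowers \<open>ceillog2\<close> by exactly one,
        which releases \<open>200 * n + 70\<close> units: enough for the round and 4 units of
        guard.\<close>
      moreover have "ceillog2 (length xss) = 1 + ceillog2 ((length xss + 1) div 2)"
        using m by (subst ceillog2_rec) simp
      ultimately show "(\<exists>xss. Q xss \<and> holds_runs n xss s') \<and>
        (200 * n + 70) * ceillog2 (regs s' ''m'') + t + 1 + cost (Less (Num 1) (Reg ''m''))
        \<le> (200 * n + 70) * ceillog2 (regs s ''m'')"
        using m Q(2)[OF xss(1)] by auto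
    qed
  next
    case (4 s' t)
    have "regs s ''m'' = n"
      using s by (simp add: holds_runs_def)
    then show ?case using 4 by (auto simp: holds_runs_def split: if_splits)
  qed
  have "wp W orc (While (Less (Reg ''i'') (Reg ''n'')) init) s0
    (\<lambda>s t. regs s ''n'' = n \<and> map (arrs s ''out'') [0..<n] = [0..<n] \<and>
      map (arrs s ''L'') [0..<n] = replicate n 1 \<and> t \<le> 20 * n + 10)"
  proof (rule wp_While[where I = "\<lambda>s. regs s ''i'' \<le> n \<and>
        map (arrs s ''out'') [0..<regs s ''i''] = [0..<regs s ''i''] \<and>
        map (arrs s ''L'') [0..<regs s ''i''] = replicate (regs s ''i'') 1" and
        \<Phi> = "\<lambda>s. 20 * (n - regs s ''i'')"], goal_cases)
    case (3 s)
    then show ?case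
      using W s0 by (simp add: init_def wp_simps unchanged_def replicate_append_same split: if_splits)
  next
    case (4 s t)
    then have "regs s ''i'' = n" "regs s ''n'' = n"
      using s0 by (auto simp: init_def unchanged_def split: if_splits)
    with 4 s0 show ?case by simp
  qed (use W s0 in \<open>auto simp: unchanged_def init_def\<close>)
  then have "wp W orc (While (Less (Reg ''i'') (Reg ''n'')) init) s0
    (\<lambda>s t. wp W orc (Seq (Assign ''m'' (Reg ''n'')) (Seq (Assign ''p'' (Reg ''n''))
       (While (Less (Num 1) (Reg ''m'')) merge_round))) s
    (\<lambda>s t'. (\<exists>xss. Q xss \<and> length xss \<le> 1 \<and> holds_runs n xss s) \<and>
        t + t' \<le> 20 * n + (200 * n + 70) * ceillog2 n + 30))"
  proof (rule wp_mono, elim conjE)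
    fix s :: state and t
    assume *: "regs s ''n'' = n" "map (arrs s ''out'') [0..<n] = [0..<n]"
      "map (arrs s ''L'') [0..<n] = replicate n 1" and t: "t \<le> 20 * n + 10"
    define s1 where "s1 = s\<lparr>regs := (regs s)(''m'' := n, ''p'' := n)\<rparr>"
    have "holds_runs n (map (\<lambda>i. [i]) [0..<n]) s1"
      using * by (simp add: s1_def holds_runs_def comp_def map_replicate_const atLeast0LessThan
          del: map_eq_conv)
    note wp_mono[OF loop[OF this]]
    then show "wp W orc (Seq (Assign ''m'' (Reg ''n'')) (Seq (Assign ''p'' (Reg ''n''))
       (While (Less (Num 1) (Reg ''m'')) merge_round))) s
    (\<lambda>s t'. (\<exists>xss. Q xss \<and> length xss \<le> 1 \<and> holds_runs n xss s) \<and>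
        t + t' \<le> 20 * n + (200 * n + 70) * ceillog2 n + 30)"
      using t W *(1) by (simp add: wp_Seq wp_Assign s1_def[symmetric])
  qed
  then show ?thesis
    unfolding merge_sort_def init_def[symmetric] wp_Seq[of _ _ "While _ init"] .
qed

subsection \<open>Correctness and running time\<close>

lemma sorted_wrt_comparable:
  "sorted_wrt R xs \<Longrightarrow> x \<in> set xs \<Longrightarrow> y \<in> set xs \<Longrightarrow> x = y \<or> R x y \<or> R y x"
  by (induction xs) auto

lemma lists_chain_sorted_wrt:
  assumes "partial_order_on (set xs) P" "distinct l" "set l \<subseteq> {..<length xs}"
    and "sorted_wrt (\<lambda>i j. prec P (xs ! i) (xs ! j)) l"
  shows "lists_chain xs P l"
proof -
  have "(xs ! i, xs ! j) \<in> P \<or> (xs ! j, xs ! i) \<in> P" if "i \<in> set l" "j \<in> set l" for i j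
  proof (cases "i = j")
    case True
    have "xs ! i \<in> set xs" using that assms(3) by auto
    with True show ?thesis
      using partial_order_onD(1)[OF assms(1)] by (simp add: refl_onD)
  next
    case False
    then show ?thesis
      using sorted_wrt_comparable[OF assms(4) that] by (auto simp: prec_def)
  qed
  then show ?thesis
    using assms by (auto simp: lists_chain_def Chains_def)
qed

section \<open>From executions to the asymptotic bound\<close>

lemma computes_withinI:
  assumes "wp (n + 2) orc alg (input_state inp) (\<lambda>s t. t \<le> B \<and> R (output_list s))"
  shows "\<exists>out. computes_within alg 1 n orc inp (real B) (real B) out \<and> R out"
proof -
  obtain t q s where "exec (n + 2) orc alg (input_state inp) t q s" "t \<le> B" "R (output_list s)"
    using assms unfolding wp_def by blast
  moreover from this(1) have "q \<le> t" by (rule exec_queries_le_time)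
  ultimately show ?thesis
    unfolding computes_within_def
    by (intro exI[of _ "output_list s"] conjI exI[of _ t] exI[of _ q] exI[of _ s]) auto
qed

text \<open>The last constant exceeds the one for the sort by 10, to pay for the final assignment to
  \<open>len\<close>.\<close>

definition time_bound :: "nat \<Rightarrow> nat" where
  "time_bound n = 20 * n + (200 * n + 70) * ceillog2 n + 40"

text \<open>From \<open>n = 2\<close> on the binary logarithm \<open>u\<close> is at least 1 and
  absorbs the rounding and the lower terms: 600 is 270 * 2 + 20 + 40. The factor
  \<open>1 / ln 2\<close> changes the base.\<close>

lemma time_bound_bigo: "(\<lambda>n. real (time_bound n)) \<in> O(\<lambda>n. real n * ln (real n))"
proof (rule bigoI)
  show "\<forall>\<^sub>F n in at_top. norm (real (time_bound n)) \<le> 600 / ln 2 * norm (real n * ln (real n))"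
    using eventually_ge_at_top[of "2 :: nat"]
  proof eventually_elim
    case (elim n)
    define u where "u = log 2 (real n)"
    have u: "1 \<le> u"
      using elim by (simp add: u_def le_log_iff)
    have n: "1 \<le> real n" using elim by simp
    have "real (ceillog2 n) \<le> u + 1"
      using ceillog2_less_log[of n] elim by (simp add: u_def)
    then have "real (ceillog2 n) \<le> 2 * u"
      using u by simp
    then have "(200 * real n + 70) * real (ceillog2 n) \<le> (270 * real n) * (2 * u)"
      using n by (intro mult_mono) auto
    moreover have nu: "real n \<le> real n * u" "1 \<le> real n * u"
      using mult_mono[of 1 "real n" 1 u] n u by simp_all
    ultimately have "real (time_bound n) \<le> 600 * (real n * u)"
      by (simp add: time_bound_def)
    also have "\<dots> = 600 / ln 2 * (real n * ln (real n))"
      by (simp add: u_def log_def)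
    also have "real n * ln (real n) = norm (real n * ln (real n))"
      using n by simp
    finally show ?case by simp
  qed
qed

theorem theorem4:
  shows "\<exists>(alg :: com) (alg' :: com) (d :: nat) (T :: nat \<Rightarrow> real) (Q :: nat \<Rightarrow> real).
    T \<in> O(\<lambda>n. real n * ln (real n)) \<and> Q \<in> O(\<lambda>n. real n * ln (real n)) \<and>
    (\<forall>(xs :: 'a list) (P :: 'a rel) (orc :: nat \<Rightarrow> nat \<Rightarrow> bool) (n :: nat) (k :: nat).
       distinct xs \<and> length xs = n \<and> partial_order_on (set xs) P \<and> partial_oracle xs P orc \<and>
       k \<le> n \<and> (\<exists>C. maximum_chain P C \<and> card C = n - k) \<longrightarrow>
       (\<exists>out. computes_within alg d n orc ((\<lambda>_. 0)(''n'' := n)) (T n) (Q n) out \<and>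
          lists_chain xs P out \<and> int (length out) \<ge> int n - 2 * int k) \<and>
       (\<exists>out. computes_within alg' d n orc ((\<lambda>_. 0)(''n'' := n, ''k'' := k)) (T n) (Q n) out \<and>
          lists_chain xs P out \<and> length out = n - 2 * k))"
proof -
  \<comment> \<open>Without \<open>k\<close> all survivors are returned; with \<open>k\<close>
    known, the output is cut after \<open>n - k - k\<close> entries. Truncated subtraction makes
    this 0 when \<open>2 * k\<close> exceeds \<open>n\<close>.\<close>
  define alg where "alg = Seq merge_sort (Assign ''len'' (Reg ''p''))"
  define alg' where
    "alg' = Seq merge_sort (Assign ''len'' (Minus (Minus (Reg ''n'') (Reg ''k'')) (Reg ''k'')))"
  \<comment> \<open>The second program reads both inputs again after sorting, so they must survive
    it.\<close>
  have written: "''n'' \<notin> written_regs merge_sort" "''k'' \<notin> written_regs merge_sort"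
    by (simp_all add: merge_sort_def merge_round_def written_merge_pair)
  have main: "(\<exists>out. computes_within alg 1 n orc ((\<lambda>_. 0)(''n'' := n)) (time_bound n) (time_bound n) out \<and>
          lists_chain xs P out \<and> int (length out) \<ge> int n - 2 * int k) \<and>
       (\<exists>out. computes_within alg' 1 n orc ((\<lambda>_. 0)(''n'' := n, ''k'' := k)) (time_bound n) (time_bound n) out \<and>
          lists_chain xs P out \<and> length out = n - 2 * k)"
    if xs: "distinct xs" "length xs = n" and P: "partial_order_on (set xs) P"
      and orc: "partial_oracle xs P orc" and "k \<le> n"
      and C: "maximum_chain P C" "card C = n - k"
    for xs :: "'a list" and P orc n k C
  proof -
    define R where "R = (\<lambda>i j. prec P (xs ! i) (xs ! j))"
    \<comment> \<open>The chain is pulled back to positions, the only objects that the program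
      handles.\<close>
    define D where "D = {i. i < n \<and> xs ! i \<in> C}"
    define Q where "Q = chain_runs {..<n} R D (int n - 2 * int k)"
    have chain: "(x, y) \<in> P \<or> (y, x) \<in> P" if "x \<in> C" "y \<in> C" for x y
      using C(1) that by (auto simp: maximum_chain_def Chains_def)
    \<comment> \<open>Comparability of an element with itself puts it into the field of
      \<open>P\<close>.\<close>
    have "C \<subseteq> set xs"
      using chain partial_order_onD(4)[OF P] by blast
    then have "bij_betw ((!) xs) D C"
      using xs unfolding D_def bij_betw_def
      by (auto simp: inj_on_def nth_eq_iff_index_eq in_set_conv_nth image_iff subset_iff)
    then have "card D = n - k"
      using C(2) bij_betw_same_card by metis
    moreover have "{0..<n} \<inter> D = D"
      by (auto simp: D_def)
    \<comment> \<open>This is \<open>2 * (n - k) - n\<close>, where \<open>k \<le> n\<close> makes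
      the natural subtraction exact.\<close>
    ultimately have "balance D [0..<n] = int n - 2 * int k"
      using \<open>k \<le> n\<close> by (simp add: balance_distinct)
    then have Q0: "Q (map (\<lambda>i. [i]) [0..<n])"
      by (auto simp: Q_def chain_runs_def)
    have trans: "transp_on {..<n} R"
      using partial_order_onD(2,3)[OF P]
      by (auto simp: transp_on_def R_def prec_def dest: transD antisymD)
    have Qstep: "Q (merge_pairs orc xss)" if "Q xss" for xss
      using that unfolding Q_def
    proof (rule chain_runs_merge_pairs[OF trans, rotated 2])
      show "orc i j \<longleftrightarrow> R i j" if "i \<in> {..<n}" "j \<in> {..<n}" "i \<noteq> j" for i j
        using that orc xs by (simp add: partial_oracle_def R_def)
      show "R i j \<or> R j i" if "i \<in> {..<n} \<inter> D" "j \<in> {..<n} \<inter> D" "i \<noteq> j" for i j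
        using that xs chain by (auto simp: D_def R_def prec_def nth_eq_iff_index_eq)
    qed
    define good where "good s \<longleftrightarrow> (\<exists>l. sorted_wrt R l \<and> distinct l \<and> set l \<subseteq> {..<n} \<and>
      int n - 2 * int k \<le> int (length l) \<and> regs s ''p'' = length l \<and> length l \<le> n \<and>
      map (arrs s ''out'') [0..<length l] = l)" for s :: state
    have good: "good s" if Q: "Q xss" and xss: "length xss \<le> 1" and runs: "holds_runs n xss s"
      for xss s
    proof -
      have "sorted_wrt R (concat xss)"
      proof (cases xss)
        case (Cons l xss')
        then have "xss = [l]" using xss by simp
        then show ?thesis using Q by (simp add: Q_def chain_runs_def)
      qed simp
      moreover have "int n - 2 * int k \<le> int (length (concat xss))"
        using Q balance_le_length[of D "concat xss"] unfolding Q_def chain_runs_def by linarith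
      ultimately show ?thesis
        using Q runs unfolding good_def Q_def chain_runs_def holds_runs_def by blast
    qed
    have sort: "wp (n + 2) orc merge_sort (input_state inp) (\<lambda>s t. good s \<and>
        regs s ''n'' = n \<and> regs s ''k'' = inp ''k'' \<and> t + 10 \<le> time_bound n)"
      if "inp ''n'' = n" "inp ''i'' = 0" for inp
    proof (rule wp_unchanged[OF wp_merge_sort[where Q = Q and n = n]])
      fix s t
      assume "unchanged merge_sort (input_state inp) s"
        and "(\<exists>xss. Q xss \<and> length xss \<le> 1 \<and> holds_runs n xss s) \<and>
          t \<le> 20 * n + (200 * n + 70) * ceillog2 n + 30"
      then show "good s \<and> regs s ''n'' = n \<and> regs s ''k'' = inp ''k'' \<and> t + 10 \<le> time_bound n"
        using good written that by (auto simp: unchanged_def input_state_def time_bound_def)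
    qed (use that Q0 Qstep in \<open>simp_all add: input_state_def\<close>)
    have "wp (n + 2) orc alg (input_state ((\<lambda>_. 0)(''n'' := n))) (\<lambda>s t. t \<le> time_bound n \<and>
        lists_chain xs P (output_list s) \<and> int (length (output_list s)) \<ge> int n - 2 * int k)"
      unfolding alg_def wp_Seq
    proof (rule wp_mono[OF sort], goal_cases)
      case (3 s t)
      then obtain l where l: "sorted_wrt R l" "distinct l" "set l \<subseteq> {..<n}"
        "int n - 2 * int k \<le> int (length l)" "regs s ''p'' = length l" "length l \<le> n"
        "map (arrs s ''out'') [0..<length l] = l"
        unfolding good_def by blast
      have "lists_chain xs P l"
        using lists_chain_sorted_wrt[OF P l(2)] l xs by (simp add: R_def)
      then show ?case
        using 3 l by (simp add: wp_Assign output_list_def del: map_eq_conv)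
    qed auto
    moreover have "wp (n + 2) orc alg' (input_state ((\<lambda>_. 0)(''n'' := n, ''k'' := k))) (\<lambda>s t.
        t \<le> time_bound n \<and>
        lists_chain xs P (output_list s) \<and> length (output_list s) = n - 2 * k)"
      unfolding alg'_def wp_Seq
    proof (rule wp_mono[OF sort], goal_cases)
      case (3 s t)
      then obtain l where l: "sorted_wrt R l" "distinct l" "set l \<subseteq> {..<n}"
        "int n - 2 * int k \<le> int (length l)" "regs s ''p'' = length l" "length l \<le> n"
        "map (arrs s ''out'') [0..<length l] = l"
        unfolding good_def by blast
      have "n - k - k \<le> length l"
        using l(4) by linarith
      then have "map (arrs s ''out'') [0..<n - k - k] = take (n - k - k) l"
        using arg_cong[OF l(7), of "take (n - k - k)"] by (simp add: take_map del: map_eq_conv)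
      moreover have "lists_chain xs P (take (n - k - k) l)"
        using lists_chain_sorted_wrt[OF P, of "take (n - k - k) l"] l xs set_take_subset[of "n - k - k" l]
        by (auto simp: R_def sorted_wrt_take)
      ultimately show ?case
        using 3 \<open>k \<le> n\<close> by (simp add: wp_Assign output_list_def mult_2 le_diff_conv
            del: map_eq_conv)
    qed auto
    ultimately show ?thesis
      by (intro conjI computes_withinI[where R = "\<lambda>out. lists_chain xs P out \<and> _ out"])
  qed
  show ?thesis
    by (intro exI[of _ alg] exI[of _ alg'] exI[of _ 1] exI[of _ "\<lambda>n. real (time_bound n)"] conjI
        time_bound_bigo allI impI) (use main in blast)+
qed

end
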